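(* Let $n\ge3$ be odd and $G=SL_n(\mathbb{Z})$. Then $G$ has non-factorizable regular character.
   Context: A character on a countable discrete group $G$ is a function $\phi: G\to\mathbb{C}$ that is positive definite, conjugation-invariant and normalized ($\phi(e)=1$). $\delta_e$ is the Dirac function at the identity. $G$ has non-factorizable regular character if for any characters $\phi,\psi$ on $G$ such that $\phi(s)\psi(s)=0$ for all $s\in G\setminus\{e\}$, one has $\phi\equiv\delta_e$ or $\psi\equiv\delta_e$. *)

theory Defs
  imports
    Complex_Main
    "HOL-Library.Countable_Set"
    "HOL-Algebra.Group"
    "Jordan_Normal_Form.Determinant"
begin

definition special_linear_group :: "nat \<Rightarrow> 'a::comm_ring_1 mat monoid" where
  "special_linear_group n =
    \<lparr>carrier = {A \<in> carrier_mat n n. det A = 1}, monoid.mult = (*), one = 1\<^sub>m n\<rparr>"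

text \<open>The Gram sums run over arbitrary finite families of group elements (repetitions
  allowed) and complex coefficients. Each sum is required to be a real number and nonnegative.\<close>

definition positive_definite_on :: "('g, 'm) monoid_scheme \<Rightarrow> ('g \<Rightarrow> complex) \<Rightarrow> bool" where
  "positive_definite_on G \<phi> \<longleftrightarrow>
    (\<forall>(k::nat) (g :: nat \<Rightarrow> 'g) (c :: nat \<Rightarrow> complex). (\<forall>i<k. g i \<in> carrier G) \<longrightarrow>
      (let S = (\<Sum>i<k. \<Sum>j<k. c i * cnj (c j) * \<phi> (inv\<^bsub>G\<^esub> (g j) \<otimes>\<^bsub>G\<^esub> g i))
       in S \<in> \<real> \<and> 0 \<le> Re S))"

text \<open>Only the values of \<open>\<phi>\<close> on the carrier matter, here and below: a function on the
  group is represented by any extension to the ambient type.\<close>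

definition is_character :: "('g, 'm) monoid_scheme \<Rightarrow> ('g \<Rightarrow> complex) \<Rightarrow> bool" where
  "is_character G \<phi> \<longleftrightarrow>
    positive_definite_on G \<phi> \<and>
    (\<forall>g\<in>carrier G. \<forall>h\<in>carrier G. \<phi> (g \<otimes>\<^bsub>G\<^esub> h \<otimes>\<^bsub>G\<^esub> inv\<^bsub>G\<^esub> g) = \<phi> h) \<and>
    \<phi> \<one>\<^bsub>G\<^esub> = 1"

definition dirac_identity :: "('g, 'm) monoid_scheme \<Rightarrow> 'g \<Rightarrow> complex" where
  "dirac_identity G s = (if s = \<one>\<^bsub>G\<^esub> then 1 else 0)"

definition nonfactorizable_regular_character :: "('g, 'm) monoid_scheme \<Rightarrow> bool" where
  "nonfactorizable_regular_character G \<longleftrightarrow>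
    (\<forall>\<phi> \<psi>. is_character G \<phi> \<and> is_character G \<psi> \<and>
      (\<forall>s\<in>carrier G - {\<one>\<^bsub>G\<^esub>}. \<phi> s * \<psi> s = 0) \<longrightarrow>
      (\<forall>s\<in>carrier G. \<phi> s = dirac_identity G s) \<or>
      (\<forall>s\<in>carrier G. \<psi> s = dirac_identity G s))"

lemma group_special_linear_group:
  "group (special_linear_group n :: 'a::comm_ring_1 mat monoid)"
proof (rule groupI)
  fix A :: "'a mat"
  assume "A \<in> carrier (special_linear_group n)"
  then have A: "A \<in> carrier_mat n n" "det A = 1"
    by (auto simp: special_linear_group_def)
  have B: "adj_mat A \<in> carrier_mat n n" "adj_mat A * A = 1\<^sub>m n"
    using adj_mat[OF A(1)] A(2) by auto
  have "det (adj_mat A) = 1"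
    using det_mult[OF B(1) A(1)] B(2) A(2) by simp
  with B show "\<exists>B\<in>carrier (special_linear_group n).
      B \<otimes>\<^bsub>special_linear_group n\<^esub> A = \<one>\<^bsub>special_linear_group n\<^esub>"
    by (auto simp: special_linear_group_def)
qed (auto simp: special_linear_group_def det_mult)

lemma countable_special_linear_group_int:
  "countable (carrier (special_linear_group n :: int mat monoid))"
proof -
  let ?f = "\<lambda>A :: int mat. map (\<lambda>i. map (\<lambda>j. A $$ (i, j)) [0..<n]) [0..<n]"
  have "inj_on ?f (carrier_mat n n)"
    by (rule inj_onI) (rule eq_matI, auto simp: map_eq_conv)
  then have "inj_on ?f (carrier (special_linear_group n))"
    by (rule inj_on_subset) (auto simp: special_linear_group_def)
  then show ?thesis
    by (rule countableI')
qed

end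

theory Submission
  imports Defs "HOL-Library.Ramsey"
begin

text \<open>If \<open>\<phi> s \<noteq> 0\<close> and \<open>\<psi> t \<noteq> 0\<close>, then for all \<open>u\<close> and \<open>v\<close> there is \<open>m > 0\<close> such that \<open>\<phi>\<close> does not
  vanish at the commutator of \<open>s\<inverse>\<close> and \<open>u\<^sup>m\<close>, and \<open>\<psi>\<close> does not vanish at that of \<open>t\<inverse>\<close> and \<open>v\<^sup>m\<close>.
  Taking such commutators with unipotent matrices \<open>u = 1 + M\<close>, \<open>M\<^sup>2 = 0\<close>, one passes from any
  \<open>s \<noteq> 1\<close> in the support of a character to an element \<open>1 + d E\<^sub>0\<^sub>1\<close>, \<open>d \<noteq> 0\<close>, of the support; the
  start of this descent needs a nontrivial element fixing a basis vector, and oddness of \<open>n\<close>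
  excludes the obstruction \<open>s = -1\<close>. Given \<open>1 + d E\<^sub>0\<^sub>1\<close> for \<open>\<phi>\<close> and \<open>1 + e E\<^sub>0\<^sub>1\<close> for \<open>\<psi>\<close>, commutators
  with multiples of \<open>E\<^sub>2\<^sub>0\<close> yield one element \<open>1 + c d e E\<^sub>2\<^sub>1\<close> at which neither character vanishes.\<close>

section \<open>Positive definite functions and characters on a group\<close>

text \<open>Transport along an enumeration of \<open>I\<close>. It lets Gram sums be indexed by
  \<open>bool\<close> for two group elements, or by an option set when a family is extended by one
  extra element.\<close>

lemma positive_definite_on_finite_family:
  assumes pd: "positive_definite_on G \<phi>" and "finite I"
    and g: "\<And>i. i \<in> I \<Longrightarrow> g i \<in> carrier G"
  shows "(\<Sum>i\<in>I. \<Sum>j\<in>I. c i * cnj (c j) * \<phi> (inv\<^bsub>G\<^esub> (g j) \<otimes>\<^bsub>G\<^esub> g i)) \<in> \<real>"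
    and "0 \<le> Re (\<Sum>i\<in>I. \<Sum>j\<in>I. c i * cnj (c j) * \<phi> (inv\<^bsub>G\<^esub> (g j) \<otimes>\<^bsub>G\<^esub> g i))"
proof -
  obtain h where h: "bij_betw h {..<card I} I"
    using ex_bij_betw_nat_finite[OF \<open>finite I\<close>] by (auto simp: lessThan_atLeast0)
  then have "\<forall>i<card I. g (h i) \<in> carrier G"
    using g by (auto simp: bij_betw_def)
  then have *: "(\<Sum>i<card I. \<Sum>j<card I. c (h i) * cnj (c (h j))
        * \<phi> (inv\<^bsub>G\<^esub> (g (h j)) \<otimes>\<^bsub>G\<^esub> g (h i))) \<in> \<real> \<and>
      0 \<le> Re (\<Sum>i<card I. \<Sum>j<card I. c (h i) * cnj (c (h j))
        * \<phi> (inv\<^bsub>G\<^esub> (g (h j)) \<otimes>\<^bsub>G\<^esub> g (h i)))"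
    using pd[unfolded positive_definite_on_def Let_def,
        THEN spec[of _ "card I"], THEN spec[of _ "\<lambda>i. g (h i)"], THEN spec[of _ "\<lambda>i. c (h i)"]]
    by blast
  have "(\<Sum>i<card I. \<Sum>j<card I. c (h i) * cnj (c (h j))
        * \<phi> (inv\<^bsub>G\<^esub> (g (h j)) \<otimes>\<^bsub>G\<^esub> g (h i)))
      = (\<Sum>i\<in>I. \<Sum>j\<in>I. c i * cnj (c j) * \<phi> (inv\<^bsub>G\<^esub> (g j) \<otimes>\<^bsub>G\<^esub> g i))"
    by (simp add: sum.reindex_bij_betw[OF h, symmetric])
  with * show "(\<Sum>i\<in>I. \<Sum>j\<in>I. c i * cnj (c j) * \<phi> (inv\<^bsub>G\<^esub> (g j) \<otimes>\<^bsub>G\<^esub> g i)) \<in> \<real>"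
    "0 \<le> Re (\<Sum>i\<in>I. \<Sum>j\<in>I. c i * cnj (c j) * \<phi> (inv\<^bsub>G\<^esub> (g j) \<otimes>\<^bsub>G\<^esub> g i))"
    by simp_all
qed

text \<open>Only the reality of Gram sums enters. For the elements \<open>\<one>\<close>,
  \<open>s\<close> with coefficients \<open>x\<close>, 1 it says that
  \<open>cnj x * \<phi> s + x * \<phi> (inv s)\<close> is real. Taking \<open>x = 1\<close> makes
  the imaginary parts of the two values opposite, and \<open>x = \<i>\<close> makes the real parts
  equal.\<close>

lemma character_inv:
  assumes "group G" and ch: "is_character G \<phi>" and s: "s \<in> carrier G"
  shows "\<phi> (inv\<^bsub>G\<^esub> s) = cnj (\<phi> s)"
proof -
  interpret group G by fact
  have one: "\<phi> \<one>\<^bsub>G\<^esub> = 1" and pd: "positive_definite_on G \<phi>"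
    using ch by (auto simp: is_character_def)
  have real: "Im (cnj x * \<phi> s + x * \<phi> (inv\<^bsub>G\<^esub> s)) = 0" for x
  proof -
    have "(\<Sum>i\<in>UNIV. \<Sum>j\<in>UNIV. (if i then 1 else x) * cnj (if j then 1 else x) *
        \<phi> (inv\<^bsub>G\<^esub> (if j then s else \<one>\<^bsub>G\<^esub>) \<otimes>\<^bsub>G\<^esub> (if i then s else \<one>\<^bsub>G\<^esub>))) \<in> \<real>"
      by (rule positive_definite_on_finite_family(1)[OF pd]) (use s in auto)
    then have "1 + cnj x * \<phi> s + x * \<phi> (inv\<^bsub>G\<^esub> s) + x * cnj x \<in> \<real>"
      using s one by (simp add: UNIV_bool algebra_simps)
    then show ?thesis
      by (auto simp: complex_is_Real_iff algebra_simps)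
  qed
  show ?thesis
    using real[of 1] real[of \<i>] by (simp add: complex_eq_iff)
qed

text \<open>Bessel's inequality in the GNS representation of \<open>\<phi>\<close>: the translates
  of the cyclic vector by the \<open>g i\<close> are orthonormal, and each has inner product
  \<open>a\<close> with the cyclic vector, which is a unit vector.\<close>

lemma orthogonal_family_bound:
  assumes "group G" and ch: "is_character G \<phi>" and "finite I"
    and g: "\<And>i. i \<in> I \<Longrightarrow> g i \<in> carrier G" "\<And>i. i \<in> I \<Longrightarrow> \<phi> (g i) = a"
    and orth: "\<And>i j. i \<in> I \<Longrightarrow> j \<in> I \<Longrightarrow> i \<noteq> j \<Longrightarrow> \<phi> (inv\<^bsub>G\<^esub> (g j) \<otimes>\<^bsub>G\<^esub> g i) = 0"
    and "I \<noteq> {}"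
  shows "real (card I) * (cmod a)\<^sup>2 \<le> 1"
proof -
  interpret group G by fact
  have one: "\<phi> \<one>\<^bsub>G\<^esub> = 1" and pd: "positive_definite_on G \<phi>"
    using ch by (auto simp: is_character_def)
  let ?K = "of_nat (card I) :: complex"
  \<comment> \<open>The index \<open>None\<close> stands for the cyclic vector. Its coefficient
    \<open>?x\<close> subtracts from the sum of the family its projection to the cyclic vector, so
    that the Gram sum becomes \<open>K - K^2 * |a|^2\<close>, where
    \<open>K = card I\<close>.\<close>
  let ?x = "- ?K * a"
  let ?h = "\<lambda>i. case i of None \<Rightarrow> \<one>\<^bsub>G\<^esub> | Some i \<Rightarrow> g i"
  let ?c = "\<lambda>i. case i of None \<Rightarrow> ?x | Some i \<Rightarrow> 1"
  let ?J = "insert None (Some ` I)"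
  have inner: "(\<Sum>j\<in>I. \<phi> (inv\<^bsub>G\<^esub> (g j) \<otimes>\<^bsub>G\<^esub> g i)) = 1" if "i \<in> I" for i
  proof -
    have "(\<Sum>j\<in>I. \<phi> (inv\<^bsub>G\<^esub> (g j) \<otimes>\<^bsub>G\<^esub> g i)) = (\<Sum>j\<in>I. if j = i then 1 else 0)"
      by (rule sum.cong) (use that orth g one in auto)
    then show ?thesis
      using that \<open>finite I\<close> by simp
  qed
  have "0 \<le> Re (\<Sum>i\<in>?J. \<Sum>j\<in>?J. ?c i * cnj (?c j) * \<phi> (inv\<^bsub>G\<^esub> (?h j) \<otimes>\<^bsub>G\<^esub> ?h i))"
    by (rule positive_definite_on_finite_family(2)[OF pd]) (use g \<open>finite I\<close> in auto)
  also have "(\<Sum>i\<in>?J. \<Sum>j\<in>?J. ?c i * cnj (?c j) * \<phi> (inv\<^bsub>G\<^esub> (?h j) \<otimes>\<^bsub>G\<^esub> ?h i))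
      = ?x * cnj ?x + ?x * (\<Sum>j\<in>I. \<phi> (inv\<^bsub>G\<^esub> (g j)))
        + (\<Sum>i\<in>I. cnj ?x * \<phi> (g i) + (\<Sum>j\<in>I. \<phi> (inv\<^bsub>G\<^esub> (g j) \<otimes>\<^bsub>G\<^esub> g i)))"
    using \<open>finite I\<close> one g
    by (simp add: sum.reindex sum_distrib_left)
  also have "\<dots> = ?x * cnj ?x + ?x * (?K * cnj a) + ?K * (cnj ?x * a + 1)"
    using g inner by (simp add: character_inv[OF \<open>group G\<close> ch] sum.distrib algebra_simps)
  also have "\<dots> = ?K - ?K * ?K * (a * cnj a)"
    by (simp add: algebra_simps)
  also have "\<dots> = of_real (real (card I) - real (card I) * (real (card I) * (cmod a)\<^sup>2))"
    by (simp add: complex_norm_square[symmetric] algebra_simps del: of_real_power)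
  finally have "0 \<le> real (card I) * (1 - real (card I) * (cmod a)\<^sup>2)"
    by (simp add: algebra_simps)
  moreover have "0 < real (card I)"
    using \<open>finite I\<close> \<open>I \<noteq> {}\<close> by (simp add: card_gt_0_iff)
  ultimately show ?thesis
    by (simp add: zero_le_mult_iff)
qed

text \<open>The conjugates of \<open>s\<close> by powers of \<open>u\<close> have constant inner product with the cyclic vector, so
  only boundedly many of them can be pairwise orthogonal. Ramsey's theorem then yields one
  pair that is orthogonal neither for \<open>\<phi>\<close> nor for \<open>\<psi>\<close>.\<close>

lemma characters_common_commutator:
  assumes "group G" and ch: "is_character G \<phi>" "is_character G \<psi>"
    and mem: "s \<in> carrier G" "t \<in> carrier G" "u \<in> carrier G" "v \<in> carrier G"
    and nz: "\<phi> s \<noteq> 0" "\<psi> t \<noteq> 0"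
  obtains m :: nat where "m > 0"
    "\<phi> (inv\<^bsub>G\<^esub> s \<otimes>\<^bsub>G\<^esub> (u [^]\<^bsub>G\<^esub> m \<otimes>\<^bsub>G\<^esub> s \<otimes>\<^bsub>G\<^esub> inv\<^bsub>G\<^esub> (u [^]\<^bsub>G\<^esub> m))) \<noteq> 0"
    "\<psi> (inv\<^bsub>G\<^esub> t \<otimes>\<^bsub>G\<^esub> (v [^]\<^bsub>G\<^esub> m \<otimes>\<^bsub>G\<^esub> t \<otimes>\<^bsub>G\<^esub> inv\<^bsub>G\<^esub> (v [^]\<^bsub>G\<^esub> m))) \<noteq> 0"
proof -
  interpret group G by fact
  define conj where "conj = (\<lambda>x s (i::nat). x [^]\<^bsub>G\<^esub> i \<otimes>\<^bsub>G\<^esub> s \<otimes>\<^bsub>G\<^esub> inv\<^bsub>G\<^esub> (x [^]\<^bsub>G\<^esub> i))"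
  have conj_closed: "conj x s i \<in> carrier G" if "x \<in> carrier G" "s \<in> carrier G" for x s i
    using that by (simp add: conj_def)
  have conj_value: "\<chi> (conj x s i) = \<chi> s"
    if "is_character G \<chi>" "x \<in> carrier G" "s \<in> carrier G" for \<chi> x s i
    using that unfolding is_character_def conj_def by simp
  \<comment> \<open>Orthogonality is symmetric by \<open>character_inv\<close>, so it defines an
    undirected graph on the exponents.\<close>
  have conj_sym: "\<chi> (inv\<^bsub>G\<^esub> (conj x s i) \<otimes>\<^bsub>G\<^esub> conj x s j) = 0 \<longleftrightarrow>
      \<chi> (inv\<^bsub>G\<^esub> (conj x s j) \<otimes>\<^bsub>G\<^esub> conj x s i) = 0"
    if "is_character G \<chi>" "x \<in> carrier G" "s \<in> carrier G" for \<chi> x s i j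
    using character_inv[OF \<open>group G\<close> that(1), of "inv\<^bsub>G\<^esub> (conj x s i) \<otimes>\<^bsub>G\<^esub> conj x s j"]
      conj_closed[OF that(2,3)]
    by (simp add: inv_mult_group)
  \<comment> \<open>The inner product of two conjugates depends only on the difference of the
    exponents, since conjugation by the common power of \<open>x\<close> does not change
    \<open>\<chi>\<close>.\<close>
  have conj_diff: "\<chi> (inv\<^bsub>G\<^esub> (conj x s i) \<otimes>\<^bsub>G\<^esub> conj x s (i + m))
      = \<chi> (inv\<^bsub>G\<^esub> s \<otimes>\<^bsub>G\<^esub> conj x s m)"
    if "is_character G \<chi>" "x \<in> carrier G" "s \<in> carrier G" for \<chi> x s i m
  proof -
    let ?p = "x [^]\<^bsub>G\<^esub> i" and ?q = "x [^]\<^bsub>G\<^esub> m"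
    have pq: "?p \<in> carrier G" "?q \<in> carrier G" using that by auto
    have "inv\<^bsub>G\<^esub> (conj x s i) \<otimes>\<^bsub>G\<^esub> conj x s (i + m)
        = ?p \<otimes>\<^bsub>G\<^esub> (inv\<^bsub>G\<^esub> s \<otimes>\<^bsub>G\<^esub> conj x s m) \<otimes>\<^bsub>G\<^esub> inv\<^bsub>G\<^esub> ?p"
    proof -
      have c: "inv\<^bsub>G\<^esub> ?p \<otimes>\<^bsub>G\<^esub> (?p \<otimes>\<^bsub>G\<^esub> z) = z" if "z \<in> carrier G" for z
        using that pq by (simp add: m_assoc[symmetric])
      show ?thesis
        using that pq
        by (simp add: conj_def nat_pow_mult[symmetric] inv_mult_group m_assoc c)
    qed
    then show ?thesis
      using that pq conj_closed[OF that(2,3)] unfolding is_character_def by simp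
  qed
  \<comment> \<open>\<open>K\<close> is so large that \<open>K\<close> pairwise orthogonal
    conjugates would violate \<open>orthogonal_family_bound\<close> for either character.\<close>
  obtain K :: nat where K: "K > 0" "1 < real K * (cmod (\<phi> s))\<^sup>2" "1 < real K * (cmod (\<psi> t))\<^sup>2"
  proof -
    obtain K :: nat where K: "max (1 / (cmod (\<phi> s))\<^sup>2) (1 / (cmod (\<psi> t))\<^sup>2) < real K"
      using reals_Archimedean2 by blast
    moreover have "0 < real K"
      using nz by (intro le_less_trans[OF _ K]) (simp add: le_max_iff_disj)
    ultimately show ?thesis
      using that[of K] nz by (simp add: field_simps)
  qed
  obtain r where r: "\<And>(V::nat set) E. finite V \<Longrightarrow> card V \<ge> r \<Longrightarrow>
      \<exists>R\<subseteq>V. card R = K \<and> clique R E \<or> card R = K \<and> indep R E"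
    using ramsey2[of K K] by metis
  \<comment> \<open>Edges join \<open>\<phi>\<close>-orthogonal exponents. A clique of size
    \<open>K\<close> is impossible, so there is an independent set of size \<open>K\<close>. All its
    pairs are good for \<open>\<phi>\<close>, and they cannot all be orthogonal for
    \<open>\<psi>\<close>.\<close>
  define E where "E = {{i, j} | i j. i \<noteq> j \<and> \<phi> (inv\<^bsub>G\<^esub> (conj u s i) \<otimes>\<^bsub>G\<^esub> conj u s j) = 0}"
  have E: "\<phi> (inv\<^bsub>G\<^esub> (conj u s i) \<otimes>\<^bsub>G\<^esub> conj u s j) = 0 \<longleftrightarrow> {i, j} \<in> E" if "i \<noteq> j" for i j
    using that conj_sym[OF ch(1) mem(3,1)] by (auto simp: E_def doubleton_eq_iff)
  obtain R where R: "card R = K" "clique R E \<or> indep R E"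
    using r[of "{..<r}" E] by auto
  have fin: "finite R" "R \<noteq> {}"
    using R K by (auto intro: card_ge_0_finite)
  have "\<not> clique R E"
  proof
    assume "clique R E"
    then have "real (card R) * (cmod (\<phi> s))\<^sup>2 \<le> 1"
      by (intro orthogonal_family_bound[OF \<open>group G\<close> ch(1) fin(1), where g = "conj u s"])
        (use fin mem ch in \<open>auto simp: conj_closed conj_value E clique_def\<close>)
    with K R show False by simp
  qed
  with R have ind: "indep R E" by simp
  have "\<exists>i\<in>R. \<exists>j\<in>R. i \<noteq> j \<and> \<psi> (inv\<^bsub>G\<^esub> (conj v t j) \<otimes>\<^bsub>G\<^esub> conj v t i) \<noteq> 0"
  proof (rule ccontr)
    assume "\<not> ?thesis"
    then have "real (card R) * (cmod (\<psi> t))\<^sup>2 \<le> 1"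
      by (intro orthogonal_family_bound[OF \<open>group G\<close> ch(2) fin(1), where g = "conj v t"])
        (use fin mem ch in \<open>auto simp: conj_closed conj_value\<close>)
    with K R show False by simp
  qed
  then obtain i j where ij: "i \<in> R" "j \<in> R" "i < j"
    "\<psi> (inv\<^bsub>G\<^esub> (conj v t i) \<otimes>\<^bsub>G\<^esub> conj v t j) \<noteq> 0"
    using conj_sym[OF ch(2) mem(4,2)] by (metis linorder_neqE_nat)
  then have "\<phi> (inv\<^bsub>G\<^esub> (conj u s i) \<otimes>\<^bsub>G\<^esub> conj u s j) \<noteq> 0"
    using ind E by (auto simp: indep_def)
  moreover define m where "m = j - i"
  ultimately show thesis
    using that[of m] ij conj_diff[OF ch(1) mem(3,1), of i m] conj_diff[OF ch(2) mem(4,2), of i m]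
    by (simp add: conj_def)
qed

section \<open>Integer matrices: rank one matrices and unipotent one-parameter groups\<close>

abbreviation SL :: "nat \<Rightarrow> int mat monoid" where
  "SL n \<equiv> special_linear_group n"

lemma carrier_SL: "A \<in> carrier (SL n) \<longleftrightarrow> A \<in> carrier_mat n n \<and> det A = 1"
  by (simp add: special_linear_group_def)

lemma mult_SL [simp]: "A \<otimes>\<^bsub>SL n\<^esub> B = A * B"
  by (simp add: special_linear_group_def)

lemma one_SL [simp]: "\<one>\<^bsub>SL n\<^esub> = 1\<^sub>m n"
  by (simp add: special_linear_group_def)

lemma SL_carrier_mat: "A \<in> carrier (SL n) \<Longrightarrow> A \<in> carrier_mat n n"
  by (simp add: carrier_SL)

definition rank_one :: "nat \<Rightarrow> (nat \<Rightarrow> int) \<Rightarrow> (nat \<Rightarrow> int) \<Rightarrow> int mat" where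
  "rank_one n x y = mat n n (\<lambda>(i, j). x i * y j)"

lemma rank_one_carrier [simp]: "rank_one n x y \<in> carrier_mat n n"
  by (simp add: rank_one_def)

lemma dim_rank_one [simp]: "dim_row (rank_one n x y) = n" "dim_col (rank_one n x y) = n"
  by (simp_all add: rank_one_def)

lemma index_rank_one [simp]: "i < n \<Longrightarrow> j < n \<Longrightarrow> rank_one n x y $$ (i, j) = x i * y j"
  by (simp add: rank_one_def)

lemma rank_one_eqI:
  assumes "\<And>i j. i < n \<Longrightarrow> j < n \<Longrightarrow> x i * y j = x' i * y' j"
  shows "rank_one n x y = rank_one n x' y'"
  using assms by (intro eq_matI) (auto simp: rank_one_def)

lemma rank_one_eq_0:
  assumes "\<And>i j. i < n \<Longrightarrow> j < n \<Longrightarrow> x i * y j = 0"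
  shows "rank_one n x y = 0\<^sub>m n n"
  using assms by (intro eq_matI) (auto simp: rank_one_def)

lemma smult_rank_one: "c \<cdot>\<^sub>m rank_one n x y = rank_one n (\<lambda>i. c * x i) y"
  by (intro eq_matI) (auto simp: rank_one_def)

lemma mult_rank_one:
  assumes "A \<in> carrier_mat n n"
  shows "A * rank_one n x y = rank_one n (\<lambda>i. \<Sum>l<n. A $$ (i, l) * x l) y"
  using assms
  by (intro eq_matI) (auto simp: rank_one_def scalar_prod_def sum_distrib_right mult.assoc
      atLeast0LessThan)

lemma rank_one_mult:
  assumes "A \<in> carrier_mat n n"
  shows "rank_one n x y * A = rank_one n x (\<lambda>j. \<Sum>l<n. y l * A $$ (l, j))"
  using assms
  by (intro eq_matI) (auto simp: rank_one_def scalar_prod_def sum_distrib_left mult.assoc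
      atLeast0LessThan)

abbreviation matrix_unit :: "nat \<Rightarrow> nat \<Rightarrow> nat \<Rightarrow> int mat" where
  "matrix_unit n i j \<equiv> rank_one n (\<lambda>a. of_bool (a = i)) (\<lambda>b. of_bool (b = j))"

lemma matrix_unit_square: "i \<noteq> j \<Longrightarrow> matrix_unit n i j * matrix_unit n i j = 0\<^sub>m n n"
  by (subst mult_rank_one) (auto intro!: rank_one_eq_0 sum.neutral)

lemma mult_matrix_unit:
  assumes "A \<in> carrier_mat n n" "i < n"
  shows "A * matrix_unit n i j = rank_one n (\<lambda>a. A $$ (a, i)) (\<lambda>b. of_bool (b = j))"
proof -
  have "(\<Sum>l<n. A $$ (a, l) * of_bool (l = i)) = (\<Sum>l<n. if l = i then A $$ (a, i) else 0)" for a
    by (rule sum.cong) auto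
  then show ?thesis
    using assms by (simp add: mult_rank_one)
qed

lemma matrix_unit_mult:
  assumes "A \<in> carrier_mat n n" "j < n"
  shows "matrix_unit n i j * A = rank_one n (\<lambda>a. of_bool (a = i)) (\<lambda>b. A $$ (j, b))"
proof -
  have "(\<Sum>l<n. of_bool (l = j) * A $$ (l, b)) = (\<Sum>l<n. if l = j then A $$ (j, b) else 0)" for b
    by (rule sum.cong) auto
  then show ?thesis
    using assms by (simp add: rank_one_mult)
qed

abbreviation one_param :: "nat \<Rightarrow> int mat \<Rightarrow> int \<Rightarrow> int mat" where
  "one_param n M c \<equiv> 1\<^sub>m n + c \<cdot>\<^sub>m M"

lemma one_param_mult:
  assumes M: "M \<in> carrier_mat n n" and M2: "M * M = 0\<^sub>m n n"
  shows "one_param n M c * one_param n M d = one_param n M (c + d)"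
proof -
  have "one_param n M c * one_param n M d
      = (1\<^sub>m n + c \<cdot>\<^sub>m M) * 1\<^sub>m n + (1\<^sub>m n + c \<cdot>\<^sub>m M) * (d \<cdot>\<^sub>m M)"
    using M by (subst mult_add_distrib_mat[of _ n n _ n]) auto
  also have "(1\<^sub>m n + c \<cdot>\<^sub>m M) * (d \<cdot>\<^sub>m M) = d \<cdot>\<^sub>m M + c \<cdot>\<^sub>m (d \<cdot>\<^sub>m (M * M))"
    using M by (subst add_mult_distrib_mat[of _ n n]) auto
  finally show ?thesis
    using M unfolding M2 by (intro eq_matI) (auto simp: algebra_simps)
qed

text \<open>By \<open>one_param_mult\<close> the determinants at \<open>c\<close> and
  \<open>- c\<close> are mutually inverse integers, hence 1 or -1, and the determinant at
  \<open>2 * c\<close> is the square of the one at \<open>c\<close>. The even parameter thus avoids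
  computing the determinant of a unipotent matrix.\<close>

lemma one_param_SL:
  assumes M: "M \<in> carrier_mat n n" and M2: "M * M = 0\<^sub>m n n"
  shows "one_param n M (2 * c) \<in> carrier (SL n)"
proof -
  have car: "one_param n M d \<in> carrier_mat n n" for d
    using M by simp
  have "det (one_param n M c) * det (one_param n M (- c)) = det (one_param n M 0)"
    using det_mult[OF car[of c] car[of "- c"]] one_param_mult[OF M M2, of c "- c"] by simp
  also have "one_param n M 0 = 1\<^sub>m n"
    using M by (intro eq_matI) auto
  finally have "det (one_param n M c) = 1 \<or> det (one_param n M c) = -1"
    by (auto simp: zmult_eq_1_iff)
  then have "det (one_param n M (2 * c)) = 1"
    using det_mult[OF car[of c] car[of c]] one_param_mult[OF M M2, of c c] by auto
  then show ?thesis
    using car by (simp add: carrier_SL)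
qed

lemma one_param_pow:
  assumes M: "M \<in> carrier_mat n n" and M2: "M * M = 0\<^sub>m n n"
  shows "one_param n M c [^]\<^bsub>SL n\<^esub> (m :: nat) = one_param n M (int m * c)"
proof (induction m)
  case 0
  show ?case
    using M by (auto intro!: eq_matI)
next
  case (Suc m)
  then show ?case
    by (simp add: one_param_mult[OF M M2] algebra_simps)
qed

text \<open>Only \<open>s\<close> and \<open>u\<close> have to be invertible. The matrices
  \<open>w\<close> and \<open>w'\<close> may be formulas not yet known to lie in the group, or even
  singular.\<close>

lemma SL_cancel:
  assumes s: "s \<in> carrier (SL n)" and u: "u \<in> carrier (SL n)"
    and w: "w \<in> carrier_mat n n" "w' \<in> carrier_mat n n" and eq: "s * w * u = s * w' * u"
  shows "w = w'"
proof -
  interpret group "SL n" by (rule group_special_linear_group)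
  define s' u' where "s' = inv\<^bsub>SL n\<^esub> s" and "u' = inv\<^bsub>SL n\<^esub> u"
  have inv: "s' * s = 1\<^sub>m n" "u * u' = 1\<^sub>m n"
    using l_inv[OF s] r_inv[OF u] by (simp_all add: s'_def u'_def)
  have car: "s \<in> carrier_mat n n" "u \<in> carrier_mat n n" "s' \<in> carrier_mat n n" "u' \<in> carrier_mat n n"
    unfolding s'_def u'_def by (intro SL_carrier_mat inv_closed s u)+
  have "s' * (s * z * u) * u' = z" if z: "z \<in> carrier_mat n n" for z
  proof -
    have "s' * (s * z * u) * u' = (s' * s) * z * (u * u')"
      using car z by (simp add: assoc_mult_mat[of _ n n _ n _ n])
    then show ?thesis
      using z by (simp add: inv)
  qed
  from this[OF w(1)] this[OF w(2)] show ?thesis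
    unfolding eq by (rule trans[OF sym])
qed

section \<open>Commutators with unipotent matrices and the support of a character\<close>

text \<open>The matrix form of \<open>characters_common_commutator\<close>. The commutator
  \<open>w = s^-1 u s u^-1\<close> is described by \<open>s * w * u = u * s\<close>, which contains
  no inverse and identifies \<open>w\<close> through \<open>SL_cancel\<close>. Both characters share
  one parameter \<open>c\<close>.\<close>

lemma SL_characters_commutator:
  assumes ch: "is_character (SL n) \<phi>" "is_character (SL n) \<psi>"
    and s: "s \<in> carrier (SL n)" "\<phi> s \<noteq> 0" and t: "t \<in> carrier (SL n)" "\<psi> t \<noteq> 0"
    and M: "M \<in> carrier_mat n n" "M * M = 0\<^sub>m n n" and N: "N \<in> carrier_mat n n" "N * N = 0\<^sub>m n n"
  obtains c w z where "c \<noteq> 0"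
    "one_param n M c \<in> carrier (SL n)" "one_param n N c \<in> carrier (SL n)"
    "w \<in> carrier (SL n)" "\<phi> w \<noteq> 0" "s * w * one_param n M c = one_param n M c * s"
    "z \<in> carrier (SL n)" "\<psi> z \<noteq> 0" "t * z * one_param n N c = one_param n N c * t"
proof -
  interpret group "SL n" by (rule group_special_linear_group)
  \<comment> \<open>The parameter is 2 because \<open>one_param_SL\<close> gives membership for even
    parameters.\<close>
  let ?u = "one_param n M 2" and ?v = "one_param n N 2"
  have uv: "?u \<in> carrier (SL n)" "?v \<in> carrier (SL n)"
    using one_param_SL[OF M, of 1] one_param_SL[OF N, of 1] by simp_all
  obtain m :: nat where m: "m > 0"
    "\<phi> (inv\<^bsub>SL n\<^esub> s \<otimes>\<^bsub>SL n\<^esub> (?u [^]\<^bsub>SL n\<^esub> m \<otimes>\<^bsub>SL n\<^esub> s \<otimes>\<^bsub>SL n\<^esub> inv\<^bsub>SL n\<^esub> (?u [^]\<^bsub>SL n\<^esub> m))) \<noteq> 0"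
    "\<psi> (inv\<^bsub>SL n\<^esub> t \<otimes>\<^bsub>SL n\<^esub> (?v [^]\<^bsub>SL n\<^esub> m \<otimes>\<^bsub>SL n\<^esub> t \<otimes>\<^bsub>SL n\<^esub> inv\<^bsub>SL n\<^esub> (?v [^]\<^bsub>SL n\<^esub> m))) \<noteq> 0"
    by (rule characters_common_commutator[OF is_group ch s(1) t(1) uv s(2) t(2)])
  let ?w = "\<lambda>s u. inv\<^bsub>SL n\<^esub> s \<otimes>\<^bsub>SL n\<^esub> (u \<otimes>\<^bsub>SL n\<^esub> s \<otimes>\<^bsub>SL n\<^esub> inv\<^bsub>SL n\<^esub> u)"
  have w: "?w s u \<in> carrier (SL n)" "s * ?w s u * u = u * s"
    if "s \<in> carrier (SL n)" "u \<in> carrier (SL n)" for s u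
  proof -
    show "?w s u \<in> carrier (SL n)"
      using that by (intro m_closed inv_closed)
    have "s \<otimes>\<^bsub>SL n\<^esub> ?w s u \<otimes>\<^bsub>SL n\<^esub> u
        = (s \<otimes>\<^bsub>SL n\<^esub> inv\<^bsub>SL n\<^esub> s) \<otimes>\<^bsub>SL n\<^esub> (u \<otimes>\<^bsub>SL n\<^esub> s) \<otimes>\<^bsub>SL n\<^esub> (inv\<^bsub>SL n\<^esub> u \<otimes>\<^bsub>SL n\<^esub> u)"
      using that by (simp only: m_assoc m_closed inv_closed)
    also have "\<dots> = u \<otimes>\<^bsub>SL n\<^esub> s"
      using that by (simp only: r_inv l_inv l_one r_one m_closed)
    finally have "s \<otimes>\<^bsub>SL n\<^esub> ?w s u \<otimes>\<^bsub>SL n\<^esub> u = u \<otimes>\<^bsub>SL n\<^esub> s" .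
    then show "s * ?w s u * u = u * s"
      by simp
  qed
  have pow: "?u [^]\<^bsub>SL n\<^esub> m = one_param n M (int m * 2)"
    "?v [^]\<^bsub>SL n\<^esub> m = one_param n N (int m * 2)"
    by (rule one_param_pow[OF M], rule one_param_pow[OF N])
  note closed = nat_pow_closed[OF uv(1), of m] nat_pow_closed[OF uv(2), of m]
  show thesis
  proof (rule that)
    show "int m * 2 \<noteq> 0"
      using m(1) by simp
  qed (fact m(2,3)[unfolded pow] closed[unfolded pow]
      w[OF s(1) closed(1), unfolded pow] w[OF t(1) closed(2), unfolded pow])+
qed

text \<open>Since \<open>N * P\<close> vanishes, both sides expand to
  \<open>1 + N + P + P * N\<close>. So the commutator of the form \<open>s^-1 u s u^-1\<close> for
  \<open>s = 1 + N\<close>, \<open>u = 1 + P\<close> is \<open>1 + P * N\<close>, without inverting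
  \<open>1 + N\<close>.\<close>

lemma commutator_row:
  fixes N P :: "'a :: comm_ring_1 mat"
  assumes N: "N \<in> carrier_mat n n" and P: "P \<in> carrier_mat n n" and NP: "N * P = 0\<^sub>m n n"
  shows "(1\<^sub>m n + N) * (1\<^sub>m n + P * N) * (1\<^sub>m n + P) = (1\<^sub>m n + P) * (1\<^sub>m n + N)"
proof -
  have PN: "P * N \<in> carrier_mat n n"
    using N P by simp
  have z: "N * (P * X) = 0\<^sub>m n n" if "X \<in> carrier_mat n n" for X
    using N P that NP by (simp add: assoc_mult_mat[of _ n n _ n _ n, symmetric])
  have "(1\<^sub>m n + N) * (1\<^sub>m n + P * N) * (1\<^sub>m n + P)
      = 1\<^sub>m n + N + P * N + (P + 0\<^sub>m n n + 0\<^sub>m n n)"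
    using N P PN by (simp add: add_mult_distrib_mat[of _ n n _ _ n] mult_add_distrib_mat[of _ n n _ n]
        assoc_mult_mat[of _ n n _ n _ n] z NP)
  also have "\<dots> = (1\<^sub>m n + P) * (1\<^sub>m n + N)"
    using N P PN by (simp add: add_mult_distrib_mat[of _ n n _ _ n] mult_add_distrib_mat[of _ n n _ n])
      (intro eq_matI, auto simp: algebra_simps simp del: index_mult_mat(1))
  finally show ?thesis .
qed

text \<open>Here the commutator stands on the left, as \<open>u s u^-1 s^-1\<close> for
  \<open>s = 1 + N\<close>, \<open>u = 1 + P\<close>. Multiplying \<open>1 + N + P + N * P\<close>
  by \<open>N * P\<close> from the left gives just \<open>N * P\<close>, so both sides equal
  \<open>1 + N + P\<close>.\<close>

lemma commutator_column:
  fixes N P :: "'a :: comm_ring_1 mat"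
  assumes N: "N \<in> carrier_mat n n" and P: "P \<in> carrier_mat n n"
    and PN: "P * N = 0\<^sub>m n n" and PP: "P * P = 0\<^sub>m n n"
  shows "(1\<^sub>m n + (-1) \<cdot>\<^sub>m (N * P)) * (1\<^sub>m n + N) * (1\<^sub>m n + P) = (1\<^sub>m n + P) * (1\<^sub>m n + N)"
proof -
  have NP: "N * P \<in> carrier_mat n n"
    using N P by simp
  have z: "P * (N * X) = 0\<^sub>m n n" "P * (P * X) = 0\<^sub>m n n" if "X \<in> carrier_mat n n" for X
    using N P that PN PP by (simp_all add: assoc_mult_mat[of _ n n _ n _ n, symmetric])
  have prod: "(1\<^sub>m n + N) * (1\<^sub>m n + P) = 1\<^sub>m n + N + P + N * P"
    using N P NP by (simp add: add_mult_distrib_mat[of _ n n _ _ n] mult_add_distrib_mat[of _ n n _ n])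
      (intro eq_matI, auto simp: algebra_simps simp del: index_mult_mat(1))
  have absorb: "N * P * (1\<^sub>m n + N + P + N * P) = N * P"
    using N P NP by (simp add: mult_add_distrib_mat[of _ n n _ n]
        assoc_mult_mat[of _ n n _ n _ n] z PN PP)
  have "(1\<^sub>m n + (-1) \<cdot>\<^sub>m (N * P)) * (1\<^sub>m n + N) * (1\<^sub>m n + P)
      = (1\<^sub>m n + (-1) \<cdot>\<^sub>m (N * P)) * ((1\<^sub>m n + N) * (1\<^sub>m n + P))"
    using N P NP by (intro assoc_mult_mat) auto
  also have "\<dots> = 1\<^sub>m n + N + P + N * P + ((-1) \<cdot>\<^sub>m (N * P)) * (1\<^sub>m n + N + P + N * P)"
    unfolding prod using N P NP by (subst add_mult_distrib_mat[of _ n n _ _ n]) auto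
  also have "((-1) \<cdot>\<^sub>m (N * P)) * (1\<^sub>m n + N + P + N * P) = (-1) \<cdot>\<^sub>m (N * P)"
    using N P NP absorb by (subst mult_smult_assoc_mat[of _ n n _ n]) auto
  also have "1\<^sub>m n + N + P + N * P + (-1) \<cdot>\<^sub>m (N * P) = 1\<^sub>m n + P + N"
    using N P NP by (intro eq_matI) (auto simp del: index_mult_mat(1))
  also have "\<dots> = (1\<^sub>m n + P) * (1\<^sub>m n + N)"
    using N P by (simp add: add_mult_distrib_mat[of _ n n _ _ n] mult_add_distrib_mat[of _ n n _ n] PN)
  finally show ?thesis .
qed

text \<open>Elements of the support are recorded by their difference \<open>N\<close> from the
  identity, because the commutators used below act on \<open>N\<close> by multiplication from one
  side.\<close>

definition nonvanishing :: "nat \<Rightarrow> (int mat \<Rightarrow> complex) \<Rightarrow> int mat \<Rightarrow> bool" where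
  "nonvanishing n \<phi> N \<longleftrightarrow>
    N \<in> carrier_mat n n \<and> 1\<^sub>m n + N \<in> carrier (SL n) \<and> \<phi> (1\<^sub>m n + N) \<noteq> 0"

text \<open>\<open>commutator_row\<close> applied to both characters with one and the same
  \<open>c\<close>, on which the final argument depends. Taking \<open>\<phi>\<close> and
  \<open>\<psi>\<close> equal gives the version for a single character.\<close>

lemma commutator_row_common:
  assumes ch: "is_character (SL n) \<phi>" "is_character (SL n) \<psi>"
    and nv: "nonvanishing n \<phi> N" "nonvanishing n \<psi> N'"
    and M: "M \<in> carrier_mat n n" "M * M = 0\<^sub>m n n" "N * M = 0\<^sub>m n n"
    and M': "M' \<in> carrier_mat n n" "M' * M' = 0\<^sub>m n n" "N' * M' = 0\<^sub>m n n"
  obtains c where "c \<noteq> 0" "nonvanishing n \<phi> (c \<cdot>\<^sub>m (M * N))" "nonvanishing n \<psi> (c \<cdot>\<^sub>m (M' * N'))"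
proof -
  have N: "N \<in> carrier_mat n n" "1\<^sub>m n + N \<in> carrier (SL n)" "\<phi> (1\<^sub>m n + N) \<noteq> 0"
    and N': "N' \<in> carrier_mat n n" "1\<^sub>m n + N' \<in> carrier (SL n)" "\<psi> (1\<^sub>m n + N') \<noteq> 0"
    using nv by (auto simp: nonvanishing_def)
  obtain c w z where c: "c \<noteq> 0"
    and u: "one_param n M c \<in> carrier (SL n)" "one_param n M' c \<in> carrier (SL n)"
    and w: "w \<in> carrier (SL n)" "\<phi> w \<noteq> 0"
      "(1\<^sub>m n + N) * w * one_param n M c = one_param n M c * (1\<^sub>m n + N)"
    and z: "z \<in> carrier (SL n)" "\<psi> z \<noteq> 0"
      "(1\<^sub>m n + N') * z * one_param n M' c = one_param n M' c * (1\<^sub>m n + N')"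
    by (rule SL_characters_commutator[OF ch N(2,3) N'(2,3) M(1,2) M'(1,2)])
  have *: "x = 1\<^sub>m n + c \<cdot>\<^sub>m (M * N)"
    if N: "N \<in> carrier_mat n n" "1\<^sub>m n + N \<in> carrier (SL n)" and M: "M \<in> carrier_mat n n" "N * M = 0\<^sub>m n n"
      and u: "one_param n M c \<in> carrier (SL n)" and x: "x \<in> carrier (SL n)"
      and eq: "(1\<^sub>m n + N) * x * one_param n M c = one_param n M c * (1\<^sub>m n + N)" for x M N
  proof (rule SL_cancel[OF N(2) u])
    have cM: "c \<cdot>\<^sub>m M \<in> carrier_mat n n" "N * (c \<cdot>\<^sub>m M) = 0\<^sub>m n n"
      using mult_smult_distrib[OF N(1) M(1), of c] M by auto
    have "c \<cdot>\<^sub>m (M * N) = (c \<cdot>\<^sub>m M) * N"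
      using mult_smult_assoc_mat[OF M(1) N(1)] by simp
    then show "(1\<^sub>m n + N) * x * one_param n M c
        = (1\<^sub>m n + N) * (1\<^sub>m n + c \<cdot>\<^sub>m (M * N)) * one_param n M c"
      using commutator_row[OF N(1) cM] unfolding eq by simp
  qed (use N M x in \<open>auto simp: SL_carrier_mat\<close>)
  have "nonvanishing n \<phi> (c \<cdot>\<^sub>m (M * N))"
    using w *[OF N(1,2) M(1,3) u(1) w(1,3)] M N by (simp add: nonvanishing_def)
  moreover have "nonvanishing n \<psi> (c \<cdot>\<^sub>m (M' * N'))"
    using z *[OF N'(1,2) M'(1,3) u(2) z(1,3)] M' N' by (simp add: nonvanishing_def)
  ultimately show thesis
    using that c by blast
qed

text \<open>Left multiplication by the matrix unit at \<open>(k, i)\<close> puts row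
  \<open>i\<close> into row \<open>k\<close> and erases the rest. The vanishing of column
  \<open>k\<close> is the condition \<open>N * M = 0\<close> of
  \<open>commutator_row_common\<close>.\<close>

lemma nonvanishing_move_row:
  assumes ch: "is_character (SL n) \<phi>" and nv: "nonvanishing n \<phi> N"
    and ki: "k < n" "i < n" "i \<noteq> k" and zero: "\<And>a. a < n \<Longrightarrow> N $$ (a, k) = 0"
  obtains c where "c \<noteq> 0" "nonvanishing n \<phi> (rank_one n (\<lambda>a. of_bool (a = k)) (\<lambda>b. c * N $$ (i, b)))"
proof -
  let ?M = "matrix_unit n k i"
  have N: "N \<in> carrier_mat n n"
    using nv by (simp add: nonvanishing_def)
  have "N * ?M = 0\<^sub>m n n"
    unfolding mult_matrix_unit[OF N ki(1)] by (rule rank_one_eq_0) (simp add: zero)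
  then have M: "?M \<in> carrier_mat n n" "?M * ?M = 0\<^sub>m n n" "N * ?M = 0\<^sub>m n n"
    using ki by (simp_all add: matrix_unit_square)
  obtain c where c: "c \<noteq> 0" "nonvanishing n \<phi> (c \<cdot>\<^sub>m (?M * N))"
    by (rule commutator_row_common[OF ch ch nv nv M M])
  have "c \<cdot>\<^sub>m (?M * N) = rank_one n (\<lambda>a. of_bool (a = k)) (\<lambda>b. c * N $$ (i, b))"
    unfolding matrix_unit_mult[OF N ki(2)] smult_rank_one by (rule rank_one_eqI) simp
  with c show thesis
    using that by simp
qed

text \<open>The transposed move: right multiplication by the matrix unit at \<open>(j, l)\<close>
  puts column \<open>j\<close> into column \<open>l\<close>, and the vanishing of row
  \<open>l\<close> allows \<open>commutator_column\<close>.\<close>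

lemma nonvanishing_move_column:
  assumes ch: "is_character (SL n) \<phi>" and nv: "nonvanishing n \<phi> N"
    and jl: "j < n" "l < n" "j \<noteq> l" and zero: "\<And>b. b < n \<Longrightarrow> N $$ (l, b) = 0"
  obtains c where "c \<noteq> 0" "nonvanishing n \<phi> (rank_one n (\<lambda>a. c * N $$ (a, j)) (\<lambda>b. of_bool (b = l)))"
proof -
  let ?M = "matrix_unit n j l"
  have N: "N \<in> carrier_mat n n" "1\<^sub>m n + N \<in> carrier (SL n)" "\<phi> (1\<^sub>m n + N) \<noteq> 0"
    using nv by (auto simp: nonvanishing_def)
  have M: "?M \<in> carrier_mat n n" "?M * ?M = 0\<^sub>m n n"
    using jl by (simp_all add: matrix_unit_square)
  have MN: "?M * N = 0\<^sub>m n n"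
    unfolding matrix_unit_mult[OF N(1) jl(2)] by (rule rank_one_eq_0) (simp add: zero)
  obtain c w where c: "c \<noteq> 0" and u: "one_param n ?M c \<in> carrier (SL n)"
    and w: "w \<in> carrier (SL n)" "\<phi> w \<noteq> 0"
      "(1\<^sub>m n + N) * w * one_param n ?M c = one_param n ?M c * (1\<^sub>m n + N)"
    by (rule SL_characters_commutator[OF ch ch N(2,3) N(2,3) M M])
  note grp = group_special_linear_group[where 'a = int and n = n]
  note m_closed = monoid.m_closed[OF group.is_monoid[OF grp], unfolded mult_SL]
  define s' where "s' = inv\<^bsub>SL n\<^esub> (1\<^sub>m n + N)"
  have s': "s' \<in> carrier (SL n)" "s' * (1\<^sub>m n + N) = 1\<^sub>m n"
    using group.inv_closed[OF grp N(2)] group.l_inv[OF grp N(2)] by (auto simp: s'_def)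
  \<comment> \<open>\<open>commutator_column\<close> computes \<open>u s u^-1 s^-1\<close>, which is
    the conjugate of \<open>w\<close> by \<open>s = 1 + N\<close>; the character takes the same
    value there.\<close>
  define w' where "w' = (1\<^sub>m n + N) * w * s'"
  have w': "w' \<in> carrier (SL n)" "\<phi> w' \<noteq> 0"
  proof -
    show "w' \<in> carrier (SL n)"
      using m_closed[OF m_closed[OF N(2) w(1)] s'(1)] by (simp add: w'_def)
    show "\<phi> w' \<noteq> 0"
    proof -
      have "\<phi> ((1\<^sub>m n + N) \<otimes>\<^bsub>SL n\<^esub> w \<otimes>\<^bsub>SL n\<^esub> inv\<^bsub>SL n\<^esub> (1\<^sub>m n + N)) = \<phi> w"
        using ch N(2) w(1) unfolding is_character_def by blast
      then show ?thesis
        using w(2) by (simp add: w'_def s'_def)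
    qed
  qed
  let ?R = "(-1) \<cdot>\<^sub>m (N * (c \<cdot>\<^sub>m ?M))"
  have cM: "c \<cdot>\<^sub>m ?M \<in> carrier_mat n n" "(c \<cdot>\<^sub>m ?M) * N = 0\<^sub>m n n"
    "(c \<cdot>\<^sub>m ?M) * (c \<cdot>\<^sub>m ?M) = 0\<^sub>m n n"
    using mult_smult_assoc_mat[OF M(1) N(1)] mult_smult_assoc_mat[OF M(1) M(1)] 
      mult_smult_distrib[of "c \<cdot>\<^sub>m ?M" n n ?M n c] M MN by auto
  have R: "?R \<in> carrier_mat n n"
    using N(1) cM(1) by simp
  let ?S = "1\<^sub>m n + N" and ?U = "one_param n ?M c"
  have car: "?S \<in> carrier_mat n n" "?U \<in> carrier_mat n n" "w \<in> carrier_mat n n"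
    "s' \<in> carrier_mat n n" "w' \<in> carrier_mat n n" "1\<^sub>m n + ?R \<in> carrier_mat n n"
    by (rule SL_carrier_mat N(2) u w(1) s'(1) w'(1) add_carrier_mat R)+
  have "w' * ?S = ?S * w * (s' * ?S)"
    unfolding w'_def by (rule assoc_mult_mat[OF mult_carrier_mat[OF car(1,3)] car(4,1)])
  also have "\<dots> = ?S * w"
    unfolding s'(2) by (rule right_mult_one_mat[OF mult_carrier_mat[OF car(1,3)]])
  finally have "w' * ?S * ?U = (1\<^sub>m n + ?R) * ?S * ?U"
    unfolding commutator_column[OF N(1) cM] using w(3) by (rule ssubst)
  then have "w' * (?S * ?U) = (1\<^sub>m n + ?R) * (?S * ?U)"
    unfolding assoc_mult_mat[OF car(5,1,2)] assoc_mult_mat[OF car(6,1,2)] .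
  moreover have "1\<^sub>m n \<in> carrier (SL n)"
    by (simp add: carrier_SL)
  ultimately have eq: "w' = 1\<^sub>m n + ?R"
    using SL_cancel[OF _ m_closed[OF N(2) u] car(5,6), of "1\<^sub>m n"]
    unfolding left_mult_one_mat[OF car(5)] left_mult_one_mat[OF car(6)] by blast
  have "?R = (-1) \<cdot>\<^sub>m (c \<cdot>\<^sub>m (N * ?M))"
    unfolding mult_smult_distrib[OF N(1) M(1)] ..
  also have "\<dots> = rank_one n (\<lambda>a. - c * N $$ (a, j)) (\<lambda>b. of_bool (b = l))"
    unfolding mult_matrix_unit[OF N(1) jl(1)] smult_rank_one by (rule rank_one_eqI) simp
  finally have R_eq: "?R = rank_one n (\<lambda>a. - c * N $$ (a, j)) (\<lambda>b. of_bool (b = l))" .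
  show thesis
  proof (rule that)
    show "- c \<noteq> 0"
      using c by simp
    show "nonvanishing n \<phi> (rank_one n (\<lambda>a. - c * N $$ (a, j)) (\<lambda>b. of_bool (b = l)))"
      unfolding nonvanishing_def R_eq[symmetric] eq[symmetric] using w' R by blast
  qed
qed

section \<open>Descent from a nontrivial support element to an elementary matrix\<close>

lemma third_index:
  fixes n a b :: nat
  assumes "n \<ge> 3"
  obtains l where "l < n" "l \<noteq> a" "l \<noteq> b"
proof -
  have "\<exists>l\<in>{0, 1, 2 :: nat}. l \<noteq> a \<and> l \<noteq> b"
    by auto
  then obtain l where "l \<in> {0, 1, 2}" "l \<noteq> a" "l \<noteq> b"
    by blast
  then show thesis
    using that[of l] assms by auto
qed

lemma nonvanishing_diff_one:
  assumes w: "w \<in> carrier (SL n)" "\<phi> w \<noteq> 0"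
  shows "nonvanishing n \<phi> (w - 1\<^sub>m n)"
proof -
  have "1\<^sub>m n + (w - 1\<^sub>m n) = w"
    using SL_carrier_mat[OF w(1)] by (intro eq_matI) auto
  then show ?thesis
    using assms SL_carrier_mat[OF w(1)] by (simp add: nonvanishing_def minus_carrier_mat)
qed

lemma SL_diff_one_nonzero:
  assumes w: "w \<in> carrier_mat n n" "w \<noteq> 1\<^sub>m n"
  obtains i j where "i < n" "j < n" "(w - 1\<^sub>m n) $$ (i, j) \<noteq> (0 :: int)"
proof -
  have "\<exists>i<n. \<exists>j<n. w $$ (i, j) \<noteq> 1\<^sub>m n $$ (i, j)"
    using w by (metis carrier_matD eq_matI index_one_mat(2,3))
  then show thesis
    using that w(1) by auto
qed

lemma det_diagonal_int:
  fixes s :: "int mat"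
  assumes s: "s \<in> carrier_mat n n"
    and diag: "\<And>i j. i < n \<Longrightarrow> j < n \<Longrightarrow> i \<noteq> j \<Longrightarrow> s $$ (i, j) = 0"
  shows "det s = (\<Prod>i<n. s $$ (i, i))"
proof -
  have "det s = prod_list (diag_mat s)"
    by (rule det_upper_triangular[OF _ s]) (use s diag in auto)
  also have "\<dots> = (\<Prod>i<n. s $$ (i, i))"
    using s prod.distinct_set_conv_list[of "[0..<n]" "\<lambda>i. s $$ (i, i)"]
    by (simp add: diag_mat_def atLeast0LessThan)
  finally show ?thesis .
qed

text \<open>If \<open>e\<^sub>k\<close> is not an eigenvector of \<open>s\<close>, then \<open>u = 1 + c e\<^sub>k y\<^sup>T\<close> fixes both \<open>e\<^sub>k\<close> and
  \<open>s e\<^sub>k\<close> as soon as \<open>y\<close> is orthogonal to these two vectors, and so the commutator of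
  \<open>s\<inverse>\<close> and \<open>u\<close> fixes \<open>e\<^sub>k\<close>.\<close>

lemma nonvanishing_zero_column_off_diagonal:
  assumes ch: "is_character (SL n) \<phi>" and n: "n \<ge> 3"
    and s: "s \<in> carrier (SL n)" "\<phi> s \<noteq> 0"
    and ak: "a < n" "k < n" "a \<noteq> k" "s $$ (a, k) \<noteq> 0"
  obtains N i j where "nonvanishing n \<phi> N" "\<And>r. r < n \<Longrightarrow> N $$ (r, k) = 0"
    "i < n" "j < n" "N $$ (i, j) \<noteq> 0"
proof -
  obtain b where b: "b < n" "b \<noteq> a" "b \<noteq> k"
    using third_index[OF n] by metis
  \<comment> \<open>\<open>y\<close> is supported on \<open>a\<close> and \<open>b\<close>, both
    different from \<open>k\<close>, so it is orthogonal to the basis vector \<open>k\<close>. Its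
    two entries are chosen orthogonal to column \<open>k\<close> of \<open>s\<close>, and the entry
    at \<open>b\<close> is nonzero.\<close>
  define y where "y = (\<lambda>j. if j = a then s $$ (b, k) else if j = b then - s $$ (a, k) else 0)"
  have y_sum: "(\<Sum>l<n. y l * f l) = s $$ (b, k) * f a - s $$ (a, k) * f b" for f
  proof -
    have "(\<Sum>l<n. y l * f l)
        = (\<Sum>l<n. (if l = a then s $$ (b, k) * f a else 0) + (if l = b then - s $$ (a, k) * f b else 0))"
      using b by (intro sum.cong) (auto simp: y_def)
    then show ?thesis
      using ak b by (simp add: sum.distrib)
  qed
  \<comment> \<open>Right multiplication by \<open>?E\<close> keeps column \<open>k\<close> only;
    \<open>X * ?E = ?E\<close> says that \<open>X\<close> fixes the basis vector
    \<open>k\<close>.\<close>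
  let ?M = "rank_one n (\<lambda>i. of_bool (i = k)) y" and ?E = "matrix_unit n k k"
  have scar: "s \<in> carrier_mat n n"
    using s(1) by (rule SL_carrier_mat)
  have M: "?M \<in> carrier_mat n n" "?M * ?M = 0\<^sub>m n n"
    unfolding rank_one_mult[OF rank_one_carrier]
    by (simp, rule rank_one_eq_0) (use ak b in \<open>simp add: y_sum\<close>)
  obtain c w where c: "c \<noteq> 0" and u: "one_param n ?M c \<in> carrier (SL n)"
    and w: "w \<in> carrier (SL n)" "\<phi> w \<noteq> 0" "s * w * one_param n ?M c = one_param n ?M c * s"
    by (rule SL_characters_commutator[OF ch ch s s M M])
  have wcar: "w \<in> carrier_mat n n"
    using w(1) by (rule SL_carrier_mat)
  let ?U = "one_param n ?M c"
  have Ucar: "?U \<in> carrier_mat n n"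
    using u by (rule SL_carrier_mat)
  have sM: "s * ?M = rank_one n (\<lambda>i. s $$ (i, k)) y"
  proof -
    have "(\<Sum>l<n. s $$ (i, l) * of_bool (l = k)) = (\<Sum>l<n. if l = k then s $$ (i, k) else 0)" for i
      by (rule sum.cong) auto
    then show ?thesis
      using ak by (simp add: mult_rank_one[OF scar])
  qed
  have Ms: "?M * s = rank_one n (\<lambda>i. of_bool (i = k)) (\<lambda>j. s $$ (b, k) * s $$ (a, j) - s $$ (a, k) * s $$ (b, j))"
    unfolding rank_one_mult[OF scar] y_sum ..
  have U_mult: "?U * X = X + c \<cdot>\<^sub>m (?M * X)" if "X \<in> carrier_mat n n" for X
    using that M(1) by (simp add: add_mult_distrib_mat[of _ n n _ _ n] mult_smult_assoc_mat[of _ n n _ n])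
  have UE: "?U * ?E = ?E"
  proof -
    have "?M * ?E = 0\<^sub>m n n"
      unfolding mult_matrix_unit[OF M(1) ak(2)]
      by (rule rank_one_eq_0) (use ak b in \<open>auto simp: y_def\<close>)
    then show ?thesis
      unfolding U_mult[OF rank_one_carrier] by (intro eq_matI) (auto simp: rank_one_def)
  qed
  have UsE: "?U * s * ?E = s * ?E"
  proof -
    have "?M * (s * ?E) = ?M * s * ?E"
      using assoc_mult_mat[OF M(1) scar rank_one_carrier] by simp
    also have "\<dots> = 0\<^sub>m n n"
      unfolding Ms mult_matrix_unit[OF rank_one_carrier ak(2)]
      by (rule rank_one_eq_0) (use ak b in auto)
    finally have "?U * (s * ?E) = s * ?E + c \<cdot>\<^sub>m 0\<^sub>m n n"
      unfolding U_mult[OF mult_carrier_mat[OF scar rank_one_carrier]] by simp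
    also have "\<dots> = s * ?E"
      unfolding mult_matrix_unit[OF scar ak(2)] by (intro eq_matI) (auto simp: rank_one_def)
    finally show ?thesis
      unfolding assoc_mult_mat[OF Ucar scar rank_one_carrier] .
  qed
  have wE: "w * ?E = ?E"
  proof (rule SL_cancel[OF s(1)])
    show one: "1\<^sub>m n \<in> carrier (SL n)"
      by (simp add: carrier_SL)
    show E: "w * ?E \<in> carrier_mat n n" "?E \<in> carrier_mat n n"
      using wcar by simp_all
    have "s * (w * ?E) = s * w * (?U * ?E)"
      unfolding UE using assoc_mult_mat[OF scar wcar rank_one_carrier] by simp
    also have "\<dots> = s * w * ?U * ?E"
      using assoc_mult_mat[OF mult_carrier_mat[OF scar wcar] Ucar rank_one_carrier] by simp
    also have "\<dots> = s * ?E"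
      unfolding w(3) by (rule UsE)
    finally show "s * (w * ?E) * 1\<^sub>m n = s * ?E * 1\<^sub>m n"
      by simp
  qed
  have col: "(w - 1\<^sub>m n) $$ (r, k) = 0" if "r < n" for r
  proof -
    have "(w * ?E) $$ (r, k) = ?E $$ (r, k)"
      unfolding wE ..
    then show ?thesis
      unfolding mult_matrix_unit[OF wcar ak(2)] using that ak wcar by auto
  qed
  \<comment> \<open>Otherwise \<open>s\<close> commutes with \<open>?M\<close>. But at
    \<open>(a, b)\<close> the entry of \<open>s * ?M\<close> is minus the square of the nonzero
    \<open>s $$ (a, k)\<close>, while that of \<open>?M * s\<close> is 0.\<close>
  have "w \<noteq> 1\<^sub>m n"
  proof
    assume "w = 1\<^sub>m n"
    then have "s * ?U = ?U * s"
      using w(3) scar by simp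
    moreover have "s * ?U = s + c \<cdot>\<^sub>m (s * ?M)"
      using scar M(1) by (simp add: mult_add_distrib_mat[of _ n n _ n] mult_smult_distrib[of _ n n _ n])
    ultimately have "(s + c \<cdot>\<^sub>m (s * ?M)) $$ (a, b) = (s + c \<cdot>\<^sub>m (?M * s)) $$ (a, b)"
      unfolding U_mult[OF scar] by simp
    then show False
      unfolding sM Ms using ak b c scar by (simp add: y_def)
  qed
  from SL_diff_one_nonzero[OF wcar this] obtain i j where
    "i < n" "j < n" "(w - 1\<^sub>m n) $$ (i, j) \<noteq> 0" .
  with that[OF nonvanishing_diff_one[where \<phi> = \<phi>, OF w(1,2)] col] show thesis
    by blast
qed

text \<open>If \<open>s\<close> is diagonal, its entries divide the determinant 1, and as
  \<open>n\<close> is odd they are not all -1. Some entry is therefore 1, and \<open>s\<close>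
  itself already fixes a basis vector.\<close>

lemma nonvanishing_zero_column:
  assumes ch: "is_character (SL n) \<phi>" and n: "n \<ge> 3" "odd n"
    and s: "s \<in> carrier (SL n)" "s \<noteq> 1\<^sub>m n" "\<phi> s \<noteq> 0"
  obtains N k i j where "nonvanishing n \<phi> N" "k < n" "\<And>r. r < n \<Longrightarrow> N $$ (r, k) = 0"
    "i < n" "j < n" "N $$ (i, j) \<noteq> 0"
proof (cases "\<exists>a<n. \<exists>k<n. a \<noteq> k \<and> s $$ (a, k) \<noteq> 0")
  case True
  then obtain a k where ak: "a < n" "k < n" "a \<noteq> k" "s $$ (a, k) \<noteq> 0"
    by blast
  obtain N i j where N: "nonvanishing n \<phi> N" "\<And>r. r < n \<Longrightarrow> N $$ (r, k) = 0"
    "i < n" "j < n" "N $$ (i, j) \<noteq> 0"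
    using nonvanishing_zero_column_off_diagonal[OF ch n(1) s(1,3) ak] by blast
  show thesis
    by (rule that[OF N(1) ak(2) N(2-5)])
next
  case False
  then have diag: "\<And>i j. i < n \<Longrightarrow> j < n \<Longrightarrow> i \<noteq> j \<Longrightarrow> s $$ (i, j) = 0"
    by blast
  have scar: "s \<in> carrier_mat n n" and det: "det s = 1"
    using s(1) by (auto simp: carrier_SL)
  have prod: "(\<Prod>i<n. s $$ (i, i)) = 1"
    using det_diagonal_int[OF scar diag] det by simp
  have "\<exists>k<n. s $$ (k, k) = 1"
  proof (rule ccontr)
    assume neg: "\<not> ?thesis"
    have "s $$ (i, i) = -1" if "i < n" for i
    proof -
      have "s $$ (i, i) dvd 1"
        unfolding prod[symmetric] using that by (intro dvd_prodI) auto
      then show ?thesis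
        using neg that by auto
    qed
    then have "(\<Prod>i<n. s $$ (i, i)) = (-1) ^ n"
      by simp
    then show False
      using prod n(2) by simp
  qed
  then obtain k where k: "k < n" "s $$ (k, k) = 1"
    by blast
  have col: "(s - 1\<^sub>m n) $$ (r, k) = 0" if "r < n" for r
    using that k diag[of r k] scar by (cases "r = k") auto
  from SL_diff_one_nonzero[OF scar s(2)] obtain i j where
    ij: "i < n" "j < n" "(s - 1\<^sub>m n) $$ (i, j) \<noteq> 0" .
  show thesis
    by (rule that[OF nonvanishing_diff_one[where \<phi> = \<phi>, OF s(1,3)] k(1) col ij])
qed

text \<open>First a nonzero row is moved to row \<open>k\<close>, unless row \<open>k\<close> is the
  only nonzero one. Then a column with a nonzero entry is moved to a column \<open>l\<close>, which
  leaves a single entry.\<close>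

lemma nonvanishing_matrix_unit:
  assumes ch: "is_character (SL n) \<phi>" and n: "n \<ge> 3"
    and N: "nonvanishing n \<phi> N" "k < n" "\<And>r. r < n \<Longrightarrow> N $$ (r, k) = 0"
      "i < n" "j < n" "N $$ (i, j) \<noteq> 0"
  obtains l d where "l < n" "l \<noteq> k" "d \<noteq> 0" "nonvanishing n \<phi> (d \<cdot>\<^sub>m matrix_unit n k l)"
proof -
  have "\<exists>x j. nonvanishing n \<phi> (rank_one n (\<lambda>a. of_bool (a = k)) x) \<and> j < n \<and> x j \<noteq> 0"
  proof (cases "\<exists>i<n. \<exists>j<n. i \<noteq> k \<and> N $$ (i, j) \<noteq> 0")
    case True
    then obtain i j where ij: "i < n" "j < n" "i \<noteq> k" "N $$ (i, j) \<noteq> 0"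
      by blast
    obtain c where "c \<noteq> 0" "nonvanishing n \<phi> (rank_one n (\<lambda>a. of_bool (a = k)) (\<lambda>b. c * N $$ (i, b)))"
      by (rule nonvanishing_move_row[OF ch N(1,2) ij(1,3) N(3)])
    then show ?thesis
      using ij by (intro exI[of _ "\<lambda>b. c * N $$ (i, b)"] exI[of _ j]) simp
  next
    case False
    have "N = rank_one n (\<lambda>a. of_bool (a = k)) (\<lambda>b. N $$ (k, b))"
      using False N(1) by (intro eq_matI) (auto simp: nonvanishing_def rank_one_def)
    then show ?thesis
      using False N by (intro exI[of _ "\<lambda>b. N $$ (k, b)"] exI[of _ j]) auto
  qed
  then obtain x j where x: "nonvanishing n \<phi> (rank_one n (\<lambda>a. of_bool (a = k)) x)" "j < n" "x j \<noteq> 0"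
    by blast
  \<comment> \<open>With \<open>l \<noteq> k\<close> row \<open>l\<close> vanishes, as the column
    move requires, and the resulting unit is off the diagonal.\<close>
  obtain l where l: "l < n" "l \<noteq> j" "l \<noteq> k"
    by (rule third_index[OF n])
  let ?N = "rank_one n (\<lambda>a. of_bool (a = k)) x"
  have zero: "?N $$ (l, b) = 0" if "b < n" for b
    using l that by simp
  obtain c where c: "c \<noteq> 0" "nonvanishing n \<phi> (rank_one n (\<lambda>a. c * ?N $$ (a, j)) (\<lambda>b. of_bool (b = l)))"
    by (rule nonvanishing_move_column[OF ch x(1,2) l(1) l(2)[symmetric] zero])
  have "rank_one n (\<lambda>a. c * ?N $$ (a, j)) (\<lambda>b. of_bool (b = l)) = (c * x j) \<cdot>\<^sub>m matrix_unit n k l"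
    unfolding smult_rank_one using x(2) by (intro rank_one_eqI) simp
  then show thesis
    using that[OF l(1,3), of "c * x j"] c x(3) by simp
qed

lemma matrix_unit_change_row:
  assumes ch: "is_character (SL n) \<phi>" and kl: "k < n" "l < n" "k' < n" "k' \<noteq> l"
    and d: "d \<noteq> 0" "nonvanishing n \<phi> (d \<cdot>\<^sub>m matrix_unit n k l)"
  obtains d' where "d' \<noteq> 0" "nonvanishing n \<phi> (d' \<cdot>\<^sub>m matrix_unit n k' l)"
proof (cases "k' = k")
  case False
  have zero: "(d \<cdot>\<^sub>m matrix_unit n k l) $$ (a, k') = 0" if "a < n" for a
    using that kl by (simp add: smult_rank_one)
  obtain c where c: "c \<noteq> 0" "nonvanishing n \<phi>
      (rank_one n (\<lambda>a. of_bool (a = k')) (\<lambda>b. c * (d \<cdot>\<^sub>m matrix_unit n k l) $$ (k, b)))"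
    by (rule nonvanishing_move_row[OF ch d(2) kl(3,1) False[symmetric] zero])
  have "rank_one n (\<lambda>a. of_bool (a = k')) (\<lambda>b. c * (d \<cdot>\<^sub>m matrix_unit n k l) $$ (k, b))
      = (c * d) \<cdot>\<^sub>m matrix_unit n k' l"
    unfolding smult_rank_one using kl by (intro rank_one_eqI) simp
  then show thesis
    using that[of "c * d"] c d by simp
qed (use that d in blast)

lemma matrix_unit_change_column:
  assumes ch: "is_character (SL n) \<phi>" and kl: "k < n" "l < n" "l' < n" "l' \<noteq> k"
    and d: "d \<noteq> 0" "nonvanishing n \<phi> (d \<cdot>\<^sub>m matrix_unit n k l)"
  obtains d' where "d' \<noteq> 0" "nonvanishing n \<phi> (d' \<cdot>\<^sub>m matrix_unit n k l')"
proof (cases "l' = l")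
  case False
  have zero: "(d \<cdot>\<^sub>m matrix_unit n k l) $$ (l', b) = 0" if "b < n" for b
    using that kl by (simp add: smult_rank_one)
  obtain c where c: "c \<noteq> 0" "nonvanishing n \<phi>
      (rank_one n (\<lambda>a. c * (d \<cdot>\<^sub>m matrix_unit n k l) $$ (a, l)) (\<lambda>b. of_bool (b = l')))"
    by (rule nonvanishing_move_column[OF ch d(2) kl(2,3) False[symmetric] zero])
  have "rank_one n (\<lambda>a. c * (d \<cdot>\<^sub>m matrix_unit n k l) $$ (a, l)) (\<lambda>b. of_bool (b = l'))
      = (c * d) \<cdot>\<^sub>m matrix_unit n k l'"
    unfolding smult_rank_one using kl by (intro rank_one_eqI) simp
  then show thesis
    using that[of "c * d"] c d by simp
qed (use that d in blast)

lemma nonvanishing_first_matrix_unit: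
  assumes ch: "is_character (SL n) \<phi>" and n: "n \<ge> 3" "odd n"
    and s: "s \<in> carrier (SL n)" "s \<noteq> 1\<^sub>m n" "\<phi> s \<noteq> 0"
  obtains d where "d \<noteq> 0" "nonvanishing n \<phi> (d \<cdot>\<^sub>m matrix_unit n 0 1)"
proof -
  have lt: "0 < n" "1 < n"
    using n by auto
  obtain N k i j where k: "k < n" and N: "nonvanishing n \<phi> N" "k < n" "\<And>r. r < n \<Longrightarrow> N $$ (r, k) = 0"
    "i < n" "j < n" "N $$ (i, j) \<noteq> 0"
    using nonvanishing_zero_column[OF ch n s] by metis
  obtain l d where l: "l < n" "l \<noteq> k" and d: "d \<noteq> 0" "nonvanishing n \<phi> (d \<cdot>\<^sub>m matrix_unit n k l)"
    by (rule nonvanishing_matrix_unit[OF ch n(1) N])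
  \<comment> \<open>The position moves from \<open>(k, l)\<close> via \<open>(k, l')\<close> and
    \<open>(0, l')\<close> to \<open>(0, 1)\<close>; \<open>l'\<close> avoids \<open>k\<close> and 0
    so that it never meets the diagonal.\<close>
  obtain l' where l': "l' < n" "l' \<noteq> k" "l' \<noteq> 0"
    by (rule third_index[OF n(1)])
  obtain d1 where d1: "d1 \<noteq> 0" "nonvanishing n \<phi> (d1 \<cdot>\<^sub>m matrix_unit n k l')"
    by (rule matrix_unit_change_column[OF ch k l(1) l'(1,2) d])
  obtain d2 where d2: "d2 \<noteq> 0" "nonvanishing n \<phi> (d2 \<cdot>\<^sub>m matrix_unit n 0 l')"
    by (rule matrix_unit_change_row[OF ch k l'(1) lt(1) l'(3)[symmetric] d1])
  obtain d3 where "d3 \<noteq> 0" "nonvanishing n \<phi> (d3 \<cdot>\<^sub>m matrix_unit n 0 1)"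
    by (rule matrix_unit_change_column[OF ch lt(1) l'(1) lt(2) one_neq_zero d2])
  then show thesis
    by (rule that)
qed

section \<open>A nontrivial element common to the supports of two characters\<close>

theorem proposition3p13:
  fixes n :: nat
  assumes "n \<ge> 3" and "odd n"
  shows "nonfactorizable_regular_character (special_linear_group n :: int mat monoid)"
  unfolding nonfactorizable_regular_character_def
proof (intro allI impI, rule ccontr)
  fix \<phi> \<psi> :: "int mat \<Rightarrow> complex"
  assume "is_character (SL n) \<phi> \<and> is_character (SL n) \<psi> \<and>
    (\<forall>s\<in>carrier (SL n) - {\<one>\<^bsub>SL n\<^esub>}. \<phi> s * \<psi> s = 0)"
  then have ch: "is_character (SL n) \<phi>" "is_character (SL n) \<psi>"
    and disjoint: "\<And>s. s \<in> carrier (SL n) \<Longrightarrow> s \<noteq> 1\<^sub>m n \<Longrightarrow> \<phi> s * \<psi> s = 0"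
    by auto
  assume "\<not> ((\<forall>s\<in>carrier (SL n). \<phi> s = dirac_identity (SL n) s) \<or>
    (\<forall>s\<in>carrier (SL n). \<psi> s = dirac_identity (SL n) s))"
  then obtain s t where "s \<in> carrier (SL n)" "\<phi> s \<noteq> dirac_identity (SL n) s"
    and "t \<in> carrier (SL n)" "\<psi> t \<noteq> dirac_identity (SL n) t"
    by blast
  \<comment> \<open>Characters agree with the Dirac function at the identity, so a point of
    disagreement is a nontrivial element of the support.\<close>
  then have s: "s \<in> carrier (SL n)" "s \<noteq> 1\<^sub>m n" "\<phi> s \<noteq> 0"
    and t: "t \<in> carrier (SL n)" "t \<noteq> 1\<^sub>m n" "\<psi> t \<noteq> 0"
    using ch by (auto simp: dirac_identity_def is_character_def split: if_splits)
  let ?E = "matrix_unit n"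
  obtain d where d: "d \<noteq> 0" "nonvanishing n \<phi> (d \<cdot>\<^sub>m ?E 0 1)"
    by (rule nonvanishing_first_matrix_unit[OF ch(1) assms s])
  obtain e where e: "e \<noteq> 0" "nonvanishing n \<psi> (e \<cdot>\<^sub>m ?E 0 1)"
    by (rule nonvanishing_first_matrix_unit[OF ch(2) assms t])
  have lt: "0 < n" "1 < n" "2 < n"
    using assms by auto
  have mult: "(x \<cdot>\<^sub>m ?E i j) * (y \<cdot>\<^sub>m ?E k l) = (if j = k then x * y else 0) \<cdot>\<^sub>m ?E i l"
    if "i < n" "j < n" "k < n" "l < n" for x y i j k l
  proof -
    have "(x \<cdot>\<^sub>m ?E i j) * (y \<cdot>\<^sub>m ?E k l) = x \<cdot>\<^sub>m (y \<cdot>\<^sub>m (?E i j * ?E k l))"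
      by (subst mult_smult_assoc_mat[of _ n n _ n], simp, simp,
          subst mult_smult_distrib[of _ n n _ n], simp_all)
    also have "\<dots> = (if j = k then x * y else 0) \<cdot>\<^sub>m ?E i l"
      unfolding mult_matrix_unit[OF rank_one_carrier that(3)] smult_rank_one
      by (rule rank_one_eqI) (use that in auto)
    finally show ?thesis .
  qed
  have zero: "0 \<cdot>\<^sub>m ?E i j = 0\<^sub>m n n" for i j
    unfolding smult_rank_one by (rule rank_one_eq_0) simp
  \<comment> \<open>Swapping the coefficients \<open>d\<close> and \<open>e\<close> makes the two commutators coincide.\<close>
  obtain c where c: "c \<noteq> 0"
    "nonvanishing n \<phi> (c \<cdot>\<^sub>m ((e \<cdot>\<^sub>m ?E 2 0) * (d \<cdot>\<^sub>m ?E 0 1)))"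
    "nonvanishing n \<psi> (c \<cdot>\<^sub>m ((d \<cdot>\<^sub>m ?E 2 0) * (e \<cdot>\<^sub>m ?E 0 1)))"
    by (rule commutator_row_common[OF ch d(2) e(2), of "e \<cdot>\<^sub>m ?E 2 0" "d \<cdot>\<^sub>m ?E 2 0"])
      (simp_all add: mult lt[unfolded One_nat_def] zero)
  let ?w = "1\<^sub>m n + c \<cdot>\<^sub>m ((d * e) \<cdot>\<^sub>m ?E 2 1)"
  have w: "?w \<in> carrier (SL n)" "\<phi> ?w \<noteq> 0" "\<psi> ?w \<noteq> 0"
    using c(2,3) by (simp_all add: nonvanishing_def mult lt[unfolded One_nat_def] ac_simps)
  have "?w $$ (2, 1) \<noteq> 1\<^sub>m n $$ (2, 1)"
    using lt c d e by simp
  then have "?w \<noteq> 1\<^sub>m n"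
    by metis
  with disjoint w show False
    by auto
qed

end
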